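(* Let $T\subset\mathbb{R}^3$ be a non-degenerate tetrahedron with edges $s_i$, $1\le i\le 6$. For each edge $s_i$ let $\tau^i$ denote a unit vector parallel to $s_i$, and define the degrees of freedom $$d_i(\underline{\boldsymbol{e}}):=\int_{s_i}\tau^i\cdot\underline{\boldsymbol{e}}\,\tau^i\,dl\qquad\forall\,\underline{\boldsymbol{e}}\in P_0(T;\mathbb{S}^3),\quad 1\le i\le 6.$$ Then the set $\{d_i:1\le i\le 6\}$ is $P_0(T;\mathbb{S}^3)$-unisolvent, i.e. a tensor field $\underline{\boldsymbol{e}}\in P_0(T;\mathbb{S}^3)$ is uniquely determined by the six numbers $d_i(\underline{\boldsymbol{e}})$, $1\le i\le 6$.
   Context: $\mathbb{S}^3$ is the space of symmetric $3\times3$ real matrices, $P_0(T;\mathbb{S}^3)$ the space of constant $\mathbb{S}^3$-valued fields on $T$, and $dl$ the length element along an edge. *)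

theory Defs
  imports "HOL-Analysis.Analysis"
begin

definition symmetric_matrices :: "(real ^ 'n ^ 'n) set"
  where "symmetric_matrices = {A. transpose A = A}"

(* Fields on T are functions with domain T, i.e. elements of "extensional T", so that two fields
   are equal iff they agree on T. *)
definition P0 :: "'a set \<Rightarrow> 'b set \<Rightarrow> ('a \<Rightarrow> 'b) set"
  where "P0 T V = {(\<lambda>x\<in>T. A) | A. A \<in> V}"

definition arclength_integral :: "(real \<Rightarrow> 'a::real_normed_vector) \<Rightarrow> ('a \<Rightarrow> real) \<Rightarrow> real"
  where "arclength_integral \<gamma> f =
    integral {0..1} (\<lambda>t. f (\<gamma> t) * norm (vector_derivative \<gamma> (at t within {0..1})))"

(* a and b are the endpoints of the edge; the value does not depend on their order. *)
definition edge_dof ::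
    "real ^ 'n \<Rightarrow> real ^ 'n \<Rightarrow> real ^ 'n \<Rightarrow> (real ^ 'n \<Rightarrow> real ^ 'n ^ 'n) \<Rightarrow> real"
  where "edge_dof a b \<tau> e = arclength_integral (linepath a b) (\<lambda>x. \<tau> \<bullet> (e x *v \<tau>))"

(* Unisolvence in the sense of Ciarlet: existence and uniqueness of the interpolant for
   arbitrary prescribed values of the degrees of freedom. *)
definition unisolvent :: "'p set \<Rightarrow> 'i set \<Rightarrow> ('i \<Rightarrow> 'p \<Rightarrow> real) \<Rightarrow> bool"
  where "unisolvent P I d \<longleftrightarrow> (\<forall>\<alpha>. \<exists>!p. p \<in> P \<and> (\<forall>i\<in>I. d i p = \<alpha> i))"

end

theory Submission imports Defs begin

text \<open>
  On a constant field the degree of freedom of the edge from \<open>a\<close> to \<open>b\<close> is the quadratic form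
  of the matrix at \<open>b - a\<close>, divided by the length of the edge. Fix a vertex \<open>p\<close> of the simplex:
  by polarization, prescribing the quadratic form on all edge vectors amounts to prescribing the
  Gram matrix \<open>G\<close> of the bilinear form in the basis of edge vectors issuing from \<open>p\<close>. With these
  vectors as the rows of an invertible matrix \<open>M\<close>, the condition reads \<open>M A M\<^sup>T = G\<close>, which has
  exactly one symmetric solution \<open>A\<close>.
\<close>

text \<open>The faces of a simplex are the hulls of the subsets of its vertex set, and the hull of
  an affinely independent set \<open>c\<close> has dimension \<open>card c - 1\<close>; dimension 1
  thus means two vertices.\<close>

lemma edge_of_simplex_iff:
  fixes C :: "'a::euclidean_space set"
  assumes "\<not> affine_dependent C"
  shows "F edge_of (convex hull C) \<longleftrightarrow> (\<exists>v\<in>C. \<exists>w\<in>C. v \<noteq> w \<and> F = closed_segment v w)"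
proof -
  have "aff_dim (convex hull c) = 1 \<longleftrightarrow> card c = 2" if "c \<subseteq> C" for c
    using affine_independent_subset[OF assms that] aff_dim_affine_independent[of c]
    by (auto simp: aff_dim_convex_hull)
  then have "F edge_of (convex hull C) \<longleftrightarrow> (\<exists>c. c \<subseteq> C \<and> card c = 2 \<and> F = convex hull c)"
    unfolding edge_of_def face_of_convex_hull_affine_independent[OF assms] by blast
  also have "\<dots> \<longleftrightarrow> (\<exists>v\<in>C. \<exists>w\<in>C. v \<noteq> w \<and> F = closed_segment v w)"
    unfolding card_2_iff segment_convex_hull by (metis empty_subsetI insert_subset)
  finally show ?thesis .
qed

lemma matrix_congruence_component:
  fixes A M :: "real ^ 'n ^ 'n"
  shows "(M ** A ** transpose M) $ i $ j = M $ i \<bullet> (A *v M $ j)"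
proof -
  have "(M ** A ** transpose M) $ i $ j = (M ** (A ** transpose M)) $ i $ j"
    by (simp add: matrix_mul_assoc)
  also have "\<dots> = M $ i \<bullet> (A *v M $ j)"
    by (simp add: matrix_matrix_mult_def matrix_vector_mult_def transpose_def inner_vec_def)
  finally show ?thesis .
qed

lemma symmetric_matrices_inner:
  assumes "A \<in> symmetric_matrices"
  shows "x \<bullet> (A *v y) = y \<bullet> (A *v x)"
proof -
  have "x \<bullet> (A *v y) = (transpose A *v x) \<bullet> y"
    by (simp only: transpose_matrix_vector dot_lmul_matrix)
  also have "\<dots> = y \<bullet> (A *v x)"
    using assms by (simp add: symmetric_matrices_def inner_commute)
  finally show ?thesis .
qed

text \<open>Congruence by the inverse of \<open>M\<close> undoes congruence by \<open>M\<close>, and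
  any congruence preserves symmetry.\<close>

lemma ex1_symmetric_congruence:
  fixes M G :: "real ^ 'n ^ 'n"
  assumes "invertible M" "G \<in> symmetric_matrices"
  shows "\<exists>!A. A \<in> symmetric_matrices \<and> M ** A ** transpose M = G"
proof -
  obtain N where N: "M ** N = mat 1" "N ** M = mat 1"
    using assms(1) unfolding invertible_def by blast
  have N': "transpose M ** transpose N = mat 1" "transpose N ** transpose M = mat 1"
    by (metis N matrix_transpose_mul transpose_mat)+
  show ?thesis
  proof (rule ex1I[of _ "N ** G ** transpose N"])
    have "M ** (N ** G ** transpose N) ** transpose M
        = (M ** N) ** G ** (transpose N ** transpose M)"
      by (simp only: matrix_mul_assoc)
    then show "N ** G ** transpose N \<in> symmetric_matrices
        \<and> M ** (N ** G ** transpose N) ** transpose M = G"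
      using assms(2) N N'
      by (simp add: symmetric_matrices_def matrix_transpose_mul transpose_transpose matrix_mul_assoc)
  next
    fix A assume "A \<in> symmetric_matrices \<and> M ** A ** transpose M = G"
    then have "N ** G ** transpose N = (N ** M) ** A ** (transpose M ** transpose N)"
      by (auto simp only: matrix_mul_assoc)
    then show "A = N ** G ** transpose N"
      using N N' by simp
  qed
qed

text \<open>Here \<open>\<beta>\<close> prescribes the quadratic form on edge vectors. Indexing by
  ordered pairs of vertices avoids numbering the edges; the two assumptions on
  \<open>\<beta>\<close> are the compatibility that this requires, the form being even and zero at
  0.\<close>

lemma ex1_symmetric_edge_values:
  fixes C :: "(real ^ 'n) set" and \<beta> :: "real ^ 'n \<Rightarrow> real ^ 'n \<Rightarrow> real"
  assumes indep: "\<not> affine_dependent C" and card: "card C = CARD('n) + 1"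
    and \<beta>_commute: "\<And>v w. \<beta> v w = \<beta> w v" and \<beta>_refl: "\<And>v. \<beta> v v = 0"
  shows "\<exists>!A. A \<in> symmetric_matrices \<and> (\<forall>v\<in>C. \<forall>w\<in>C. (w - v) \<bullet> (A *v (w - v)) = \<beta> v w)"
proof -
  have "finite C"
    using card by (metis add_is_0 card.infinite one_neq_zero)
  obtain p where p: "p \<in> C"
    using card by fastforce
  have "card (C - {p}) = CARD('n)"
    using card p \<open>finite C\<close> by simp
  then obtain f where f: "bij_betw f (UNIV :: 'n set) (C - {p})"
    using \<open>finite C\<close> by (metis finite finite_Diff finite_same_card_bij)
  then have f_image: "f ` UNIV = C - {p}"
    by (simp add: bij_betw_def)
  define M :: "real ^ 'n ^ 'n" where "M = (\<chi> i. f i - p)"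
  define G :: "real ^ 'n ^ 'n"
    \<comment> \<open>Polarization for \<open>x = f i - p\<close> and \<open>y = f j - p\<close>:
      their difference is the vector of the edge opposite to \<open>p\<close> in the triangle
      \<open>p\<close>, \<open>f i\<close>, \<open>f j\<close>. On the diagonal the entry reduces to
      \<open>\<beta> p (f i)\<close>.\<close>
    where "G = (\<chi> i j. (\<beta> p (f i) + \<beta> p (f j) - \<beta> (f i) (f j)) / 2)"
  have rows: "rows M = (\<lambda>v. v - p) ` (C - {p})"
    unfolding f_image[symmetric]
    by (auto simp: rows_def row_def M_def vec_lambda_eta simp flip: vector_minus_component)
  \<comment> \<open>Affine independence of \<open>C\<close> is linear independence of the
    differences to \<open>p\<close>; there are \<open>CARD('n)\<close> of them, so they form a
    basis.\<close>
  have "independent (rows M)"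
    using indep affine_dependent_iff_dependent2[OF p]
    by (simp add: rows image_def algebra_simps)
  moreover have "card (rows M) = CARD('n)"
    unfolding rows by (subst card_image) (auto simp: inj_on_def \<open>card (C - {p}) = CARD('n)\<close>)
  ultimately have "span (rows M) = UNIV"
    using card_ge_dim_independent[of "rows M" UNIV] by auto
  then have "invertible M"
    by (simp add: invertible_left_inverse matrix_left_invertible_span_rows)
  moreover have "G \<in> symmetric_matrices"
    by (simp add: symmetric_matrices_def G_def transpose_def vec_eq_iff \<beta>_commute add.commute)
  moreover have "(\<forall>v\<in>C. \<forall>w\<in>C. (w - v) \<bullet> (A *v (w - v)) = \<beta> v w)
      \<longleftrightarrow> M ** A ** transpose M = G" (is "?L \<longleftrightarrow> ?R")
    if A: "A \<in> symmetric_matrices" for A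
  proof -
    let ?q = "\<lambda>x. x \<bullet> (A *v x)"
    have polar: "x \<bullet> (A *v y) = (?q x + ?q y - ?q (y - x)) / 2" for x y
      using symmetric_matrices_inner[OF A, of x y]
      by (simp add: matrix_vector_mult_diff_distrib inner_diff)
    have R: "?R \<longleftrightarrow> (\<forall>i j. (f i - p) \<bullet> (A *v (f j - p)) = G $ i $ j)"
      by (simp add: vec_eq_iff matrix_congruence_component M_def)
    show ?thesis
    proof
      assume L: ?L
      have "f i \<in> C" for i
        using f_image by blast
      then have "(f i - p) \<bullet> (A *v (f j - p)) = G $ i $ j" for i j
        using L p polar[of "f i - p" "f j - p"] by (simp add: G_def)
      then show ?R
        using R by blast
    next
      assume ?R
      then have G: "(f i - p) \<bullet> (A *v (f j - p)) = G $ i $ j" for i j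
        using R by blast
      \<comment> \<open>The diagonal of \<open>G\<close> gives the edges through \<open>p\<close>;
        the off-diagonal entries then give the remaining edges by polarization.\<close>
      have base: "?q (v - p) = \<beta> p v" if "v \<in> C" for v
      proof (cases "v = p")
        case False
        then obtain i where "v = f i"
          using \<open>v \<in> C\<close> f_image by blast
        then show ?thesis
          using G[of i i] by (simp add: G_def \<beta>_refl)
      qed (simp add: \<beta>_refl)
      show ?L
      proof (intro ballI)
        fix v w assume vw: "v \<in> C" "w \<in> C"
        consider "v = p" | "w = p" | i j where "v = f i" "w = f j"
          using vw f_image by blast
        then show "?q (w - v) = \<beta> v w"
        proof cases
          case 1
          then show ?thesis using base vw by simp
        next
          case 2
          have "?q (p - v) = ?q (v - p)"
            by (simp add: matrix_vector_mult_diff_distrib inner_diff)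
          then show ?thesis using 2 base vw \<beta>_commute by metis
        next
          case 3
          then show ?thesis
            using polar[of "v - p" "w - p"] base[OF vw(1)] base[OF vw(2)] G[of i j]
            by (simp add: G_def)
        qed
      qed
    qed
  qed
  ultimately show ?thesis
    using ex1_symmetric_congruence[of M G] by (simp cong: conj_cong)
qed

text \<open>The integrand is constant. As \<open>\<tau>\<close> is a unit vector, \<open>c\<close>
  is determined up to sign, and only its square enters, so the orientation of \<open>\<tau>\<close>
  does not matter.\<close>

lemma edge_dof_const:
  assumes seg: "closed_segment a b \<subseteq> T" and unit: "norm \<tau> = 1" and \<tau>: "\<tau> = c *\<^sub>R (b - a)"
  shows "edge_dof a b \<tau> (\<lambda>x\<in>T. A) = (b - a) \<bullet> (A *v (b - a)) / norm (b - a)"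
proof -
  have "edge_dof a b \<tau> (\<lambda>x\<in>T. A)
      = integral {0..1} (\<lambda>t::real. (\<tau> \<bullet> (A *v \<tau>)) * norm (b - a))"
    unfolding edge_dof_def arclength_integral_def
  proof (rule integral_cong)
    fix t :: real assume t: "t \<in> {0..1}"
    \<comment> \<open>The restricted field has the value \<open>A\<close> only on \<open>T\<close>;
      elsewhere it is \<open>undefined\<close>.\<close>
    then have "linepath a b t \<in> T"
      using seg linepath_in_path by blast
    then show "\<tau> \<bullet> ((\<lambda>x\<in>T. A) (linepath a b t) *v \<tau>)
        * norm (vector_derivative (linepath a b) (at t within {0..1}))
        = (\<tau> \<bullet> (A *v \<tau>)) * norm (b - a)"
      using t by (simp add: vector_derivative_linepath_within)
  qed
  also have "\<dots> = (\<tau> \<bullet> (A *v \<tau>)) * norm (b - a)"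
    by simp
  also have "\<dots> = (b - a) \<bullet> (A *v (b - a)) * (c\<^sup>2 * norm (b - a))"
    by (simp add: \<tau> power2_eq_square matrix_vector_mult_scaleR)
  also have "c\<^sup>2 * norm (b - a) = 1 / norm (b - a)"
  proof -
    have "\<bar>c\<bar> * norm (b - a) = 1"
      using unit by (simp add: \<tau>)
    then have "c\<^sup>2 * (norm (b - a))\<^sup>2 = 1" "norm (b - a) \<noteq> 0"
      by (metis power2_abs power_mult_distrib power_one) (use \<open>\<bar>c\<bar> * norm (b - a) = 1\<close> in auto)
    then show ?thesis
      by (simp add: field_simps power2_eq_square)
  qed
  finally show ?thesis
    by (simp only: times_divide_eq_right mult_1_right)
qed

theorem lemma3p1:
  fixes T :: "(real ^ 3) set"
    and s :: "nat \<Rightarrow> (real ^ 3) set"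
    and a b \<tau> :: "nat \<Rightarrow> real ^ 3"
  assumes tetrahedron: "3 simplex T"
    and edges: "bij_betw s {1..6} {F. F edge_of T}"
    and endpoints: "\<And>i. i \<in> {1..6} \<Longrightarrow> s i = closed_segment (a i) (b i)"
    and unit: "\<And>i. i \<in> {1..6} \<Longrightarrow> norm (\<tau> i) = 1"
    and parallel: "\<And>i. i \<in> {1..6} \<Longrightarrow> \<exists>c. \<tau> i = c *\<^sub>R (b i - a i)"
  shows "unisolvent (P0 T symmetric_matrices) {1..6} (\<lambda>i. edge_dof (a i) (b i) (\<tau> i))
    \<and> (\<forall>e \<in> P0 T symmetric_matrices. \<forall>e' \<in> P0 T symmetric_matrices.
         (\<forall>i\<in>{1..6}. edge_dof (a i) (b i) (\<tau> i) e = edge_dof (a i) (b i) (\<tau> i) e') \<longrightarrow> e = e')"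
proof -
  obtain C where C: "\<not> affine_dependent C" "card C = CARD(3) + 1" "T = convex hull C"
    using tetrahedron unfolding simplex_def by force
  let ?E = "{F. F edge_of T}"
  let ?d = "\<lambda>i. edge_dof (a i) (b i) (\<tau> i)"
  have E: "F \<in> ?E \<longleftrightarrow> (\<exists>v\<in>C. \<exists>w\<in>C. v \<noteq> w \<and> F = closed_segment v w)" for F
    using edge_of_simplex_iff[OF C(1)] C(3) by simp
  have s_edge: "s i \<in> ?E" if "i \<in> {1..6}" for i
    using edges that by (auto simp: bij_betw_def)
  have ab: "a i \<in> C" "b i \<in> C" "a i \<noteq> b i" if i: "i \<in> {1..6}" for i
  proof -
    obtain v w where "v \<in> C" "w \<in> C" "v \<noteq> w" "closed_segment (a i) (b i) = closed_segment v w"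
      using s_edge[OF i] endpoints[OF i] E by metis
    \<comment> \<open>A segment determines its endpoints up to order.\<close>
    then show "a i \<in> C" "b i \<in> C" "a i \<noteq> b i"
      by (auto simp: doubleton_eq_iff)
  qed
  have dof: "?d i (\<lambda>x\<in>T. A) = (b i - a i) \<bullet> (A *v (b i - a i)) / norm (b i - a i)"
    if i: "i \<in> {1..6}" for i A
  proof -
    have "closed_segment (a i) (b i) \<subseteq> T"
      using s_edge[OF i] endpoints[OF i] edge_of_imp_subset by auto
    then show ?thesis
      using edge_dof_const unit[OF i] parallel[OF i] by metis
  qed
  have ex1: "\<exists>!e. e \<in> P0 T symmetric_matrices \<and> (\<forall>i\<in>{1..6}. ?d i e = \<alpha> i)" for \<alpha>
  proof -
    \<comment> \<open>The data \<open>\<alpha>\<close> is carried over from edge numbers to pairs of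
      vertices by inverting \<open>s\<close>; the factor \<open>norm (w - v)\<close> clears the
      denominator in \<open>dof\<close>. On the diagonal the segment is no edge, hence the separate
      value 0.\<close>
    define \<beta> where "\<beta> v w = (if v = w then 0
        else \<alpha> (the_inv_into {1..6} s (closed_segment v w)) * norm (w - v))" for v w
    have \<beta>_edge: "\<beta> (a i) (b i) = \<alpha> i * norm (b i - a i)" if i: "i \<in> {1..6}" for i
      using the_inv_into_f_f[OF bij_betw_imp_inj_on[OF edges] i] endpoints[OF i] ab(3)[OF i]
      by (simp add: \<beta>_def)
    have \<beta>_commute: "\<beta> v w = \<beta> w v" and \<beta>_refl: "\<beta> v v = 0" for v w
      by (simp_all add: \<beta>_def closed_segment_commute norm_minus_commute)
    have dofs_iff: "(\<forall>i\<in>{1..6}. ?d i (\<lambda>x\<in>T. A) = \<alpha> i)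
        \<longleftrightarrow> (\<forall>v\<in>C. \<forall>w\<in>C. (w - v) \<bullet> (A *v (w - v)) = \<beta> v w)" (is "?L \<longleftrightarrow> ?R") for A
    proof
      assume L: ?L
      show ?R
      proof (intro ballI)
        fix v w assume vw: "v \<in> C" "w \<in> C"
        show "(w - v) \<bullet> (A *v (w - v)) = \<beta> v w"
        proof (cases "v = w")
          case False
          then have "closed_segment v w \<in> ?E"
            using E vw by blast
          then obtain i where i: "i \<in> {1..6}" "s i = closed_segment v w"
            using edges by (metis bij_betw_def imageE)
          have Q: "(b i - a i) \<bullet> (A *v (b i - a i)) = \<beta> (a i) (b i)"
            using L i(1) dof[OF i(1), of A] ab(3)[OF i(1)] by (auto simp: \<beta>_edge field_simps)
          \<comment> \<open>The given endpoints may run through the edge in the opposite direction;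
            evenness of the quadratic form settles that case.\<close>
          have "(v = a i \<and> w = b i) \<or> (v = b i \<and> w = a i)"
            using endpoints[OF i(1)] i(2) by (auto simp: doubleton_eq_iff)
          then show ?thesis
          proof
            assume "v = b i \<and> w = a i"
            moreover have "(a i - b i) \<bullet> (A *v (a i - b i)) = (b i - a i) \<bullet> (A *v (b i - a i))"
              by (simp add: matrix_vector_mult_diff_distrib inner_diff)
            ultimately show ?thesis
              using Q \<beta>_commute by metis
          qed (use Q in simp)
        qed (simp add: \<beta>_refl)
      qed
    next
      assume ?R
      show ?L
      proof
        fix i :: nat assume i: "i \<in> {1..6}"
        show "?d i (\<lambda>x\<in>T. A) = \<alpha> i"
          unfolding dof[OF i] using \<open>?R\<close> ab[OF i] \<beta>_edge[OF i] by simp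
      qed
    qed
    obtain A where A: "A \<in> symmetric_matrices" "\<forall>i\<in>{1..6}. ?d i (\<lambda>x\<in>T. A) = \<alpha> i"
      and A_unique: "\<And>B. B \<in> symmetric_matrices \<Longrightarrow> \<forall>i\<in>{1..6}. ?d i (\<lambda>x\<in>T. B) = \<alpha> i \<Longrightarrow> B = A"
      using ex1_symmetric_edge_values[OF C(1,2), of \<beta>, OF \<beta>_commute \<beta>_refl]
      unfolding dofs_iff by blast
    show ?thesis
    proof (rule ex1I[of _ "\<lambda>x\<in>T. A"])
      show "(\<lambda>x\<in>T. A) \<in> P0 T symmetric_matrices \<and> (\<forall>i\<in>{1..6}. ?d i (\<lambda>x\<in>T. A) = \<alpha> i)"
        using A unfolding P0_def by blast
      show "e = (\<lambda>x\<in>T. A)"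
        if "e \<in> P0 T symmetric_matrices \<and> (\<forall>i\<in>{1..6}. ?d i e = \<alpha> i)" for e
        using that A_unique unfolding P0_def by blast
    qed
  qed
  show ?thesis
  proof (intro conjI ballI impI)
    show "unisolvent (P0 T symmetric_matrices) {1..6} ?d"
      unfolding unisolvent_def using ex1 by blast
    show "e = e'" if "e \<in> P0 T symmetric_matrices" "e' \<in> P0 T symmetric_matrices"
      "\<forall>i\<in>{1..6}. ?d i e = ?d i e'" for e e'
      \<comment> \<open>Both fields interpolate the values of \<open>e'\<close>.\<close>
      using ex1[of "\<lambda>i. ?d i e'"] that by blast
  qed
qed

end
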